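(* Let $\Omega$ be a (non-empty) compact topological space, and let $X=\mathscr{C}(\Omega)$ be the Banach space of continuous functions from $\Omega$ to $\mathbb{R}$, endowed with the sup norm. Suppose that $T:X\to X$ is order-preserving and commutes with the addition of a constant. Then for every $x\in X$ there exists $\omega_+\in\Omega$ such that $$T^k(x)(\omega_+)\geq x(\omega_+)+k\,\overline{\rho}_+(T)$$ for all $k\in\mathbb{N}$, where $\overline{\rho}_+(T)=\inf_{y\in X}\max_{\omega\in\Omega}\big(T(y)(\omega)-y(\omega)\big)$.
   Context: $T$ is order-preserving if $x\leq y$ implies $T(x)\leq T(y)$, where $\leq$ is the pointwise partial order on functions. $T$ commutes with the addition of a constant if $T(\lambda+x)=\lambda+T(x)$ for all $\lambda\in\mathbb{R}$ and $x\in X$, where $\lambda+x$ denotes the function $\omega\mapsto\lambda+x(\omega)$. *)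

theory Defs
  imports "HOL-Analysis.Analysis"
begin

(* On a compact space every continuous real function is bounded, so bcontfun is then all of C(Omega),
   with its sup norm. *)

definition order_preserving ::
  "(('a::topological_space \<Rightarrow>\<^sub>C real) \<Rightarrow> ('a \<Rightarrow>\<^sub>C real)) \<Rightarrow> bool" where
  "order_preserving T \<longleftrightarrow>
     (\<forall>x y. (\<forall>\<omega>. apply_bcontfun x \<omega> \<le> apply_bcontfun y \<omega>) \<longrightarrow>
            (\<forall>\<omega>. apply_bcontfun (T x) \<omega> \<le> apply_bcontfun (T y) \<omega>))"

definition commutes_with_constants ::
  "(('a::topological_space \<Rightarrow>\<^sub>C real) \<Rightarrow> ('a \<Rightarrow>\<^sub>C real)) \<Rightarrow> bool" where
  "commutes_with_constants T \<longleftrightarrow>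
     (\<forall>(c::real) x. T (const_bcontfun c + x) = const_bcontfun c + T x)"

(* The inner supremum is a maximum when the space is compact, see bcontfun_attains_SUP; the
   outer infimum is taken over a set that is bounded below for the operators considered here,
   see bdd_below_SUP_displacement, so the real-valued INF is the usual one. *)
definition rho_bar_plus ::
  "(('a::topological_space \<Rightarrow>\<^sub>C real) \<Rightarrow> ('a \<Rightarrow>\<^sub>C real)) \<Rightarrow> real" where
  "rho_bar_plus T = (INF y. SUP \<omega>. apply_bcontfun (T y) \<omega> - apply_bcontfun y \<omega>)"

lemma bcontfun_attains_SUP:
  fixes f :: "'a::topological_space \<Rightarrow>\<^sub>C real"
  assumes "compact (UNIV :: 'a set)"
  shows "\<exists>\<omega>. apply_bcontfun f \<omega> = (SUP \<eta>. apply_bcontfun f \<eta>) \<and>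
             (\<forall>\<eta>. apply_bcontfun f \<eta> \<le> apply_bcontfun f \<omega>)"
proof -
  obtain w where w: "\<forall>v. apply_bcontfun f v \<le> apply_bcontfun f w"
    using continuous_attains_sup[OF assms, of "apply_bcontfun f"] by auto
  then have "(SUP v. apply_bcontfun f v) = apply_bcontfun f w"
    by (intro cSup_eq_maximum) auto
  with w show ?thesis by metis
qed

lemma bdd_below_SUP_displacement:
  fixes T :: "('a::topological_space \<Rightarrow>\<^sub>C real) \<Rightarrow> ('a \<Rightarrow>\<^sub>C real)"
  assumes comp: "compact (UNIV :: 'a set)"
    and mono: "order_preserving T" and const: "commutes_with_constants T"
  shows "bdd_below (range (\<lambda>y. SUP \<omega>. apply_bcontfun (T y) \<omega> - apply_bcontfun y \<omega>))"
proof (rule bdd_belowI2)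
  fix y :: "'a \<Rightarrow>\<^sub>C real"
  obtain w where w: "\<And>v. apply_bcontfun y w \<le> apply_bcontfun y v"
    using continuous_attains_inf[OF comp, of "apply_bcontfun y"] by auto
  let ?c = "const_bcontfun (apply_bcontfun y w) :: 'a \<Rightarrow>\<^sub>C real"
  have "apply_bcontfun (T (?c + 0)) w \<le> apply_bcontfun (T y) w"
    using mono w unfolding order_preserving_def by (simp add: const_bcontfun.rep_eq)
  then have "apply_bcontfun y w + apply_bcontfun (T 0) w \<le> apply_bcontfun (T y) w"
    using const unfolding commutes_with_constants_def
    by (metis const_bcontfun.rep_eq plus_bcontfun.rep_eq)
  moreover have "- norm (T 0) \<le> apply_bcontfun (T 0) w"
    using norm_bounded[of "T 0" w] by simp
  moreover have "apply_bcontfun (T y - y) w \<le> (SUP v. apply_bcontfun (T y - y) v)"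
    by (rule cSUP_upper[OF UNIV_I bounded_imp_bdd_above[OF bounded_apply_bcontfun]])
  ultimately show
    "- norm (T 0) \<le> (SUP \<omega>. apply_bcontfun (T y) \<omega> - apply_bcontfun y \<omega>)"
    by simp
qed

end

theory Submission
  imports Defs
begin

text \<open>
  Write \<open>\<rho>\<close> for the infimum of the largest displacement. If \<open>s < \<rho>\<close>, then no continuous \<open>y\<close>
  satisfies \<open>T y \<le> y + s\<close> everywhere. Such a \<open>y\<close> would however exist if, for some \<open>n\<close>, every point
  \<open>\<omega>\<close> had a time \<open>1 \<le> k \<le> n\<close> at which the orbit of \<open>x\<close> lags behind speed \<open>s\<close>, meaning
  \<open>T\<^sup>k x \<omega> < x \<omega> + k s\<close>: the minimum \<open>y\<close> of the drift-corrected iterates \<open>T\<^sup>k x - k s\<close> over \<open>k < n\<close>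
  would do. Indeed, \<open>T\<close> sends \<open>T\<^sup>k x - k s\<close> to the next corrected iterate plus \<open>s\<close>, so by monotonicity
  \<open>T y - s\<close> is at most the minimum over \<open>1 \<le> k \<le> n\<close>, and the lag says that the missing term
  \<open>k = 0\<close> does not lower this minimum (\<open>lagging_orbit_gives_subsolution\<close>).

  Hence for all \<open>n\<close> and \<open>s < \<rho>\<close> some point keeps up with speed \<open>s\<close> until time \<open>n\<close>
  (\<open>keeps_up_for_finite_time\<close>). The points that keep up with speed \<open>s\<close> at a given time \<open>k\<close> form a
  closed set, and these sets have the finite intersection property. By compactness one point
  keeps up at all times with all speeds \<open>s < \<rho>\<close>, and therefore with \<open>\<rho>\<close> itself.
\<close>

lemma order_preservingD:
  assumes "order_preserving T" "\<And>\<omega>. apply_bcontfun x \<omega> \<le> apply_bcontfun y \<omega>"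
  shows "apply_bcontfun (T x) \<omega> \<le> apply_bcontfun (T y) \<omega>"
  using assms unfolding order_preserving_def by blast

text \<open>
  The lower envelope is characterised by its two properties, being a lower bound and being
  attained pointwise, since these are what the comparison argument uses.
\<close>
lemma finite_lower_envelope:
  fixes f :: "nat \<Rightarrow> ('a::topological_space \<Rightarrow>\<^sub>C real)"
  assumes comp: "compact (UNIV :: 'a set)"
  shows "\<exists>y. \<forall>\<omega>. (\<forall>k\<le>n. apply_bcontfun y \<omega> \<le> apply_bcontfun (f k) \<omega>) \<and>
                  (\<exists>k\<le>n. apply_bcontfun y \<omega> = apply_bcontfun (f k) \<omega>)"
proof (induction n)
  case 0
  show ?case by auto
next
  case (Suc n)
  then obtain y where y: "\<And>\<omega> k. k \<le> n \<Longrightarrow> apply_bcontfun y \<omega> \<le> apply_bcontfun (f k) \<omega>"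
      "\<And>\<omega>. \<exists>k\<le>n. apply_bcontfun y \<omega> = apply_bcontfun (f k) \<omega>"
    by blast
  let ?g = "\<lambda>\<omega>. min (apply_bcontfun y \<omega>) (apply_bcontfun (f (Suc n)) \<omega>)"
  have cont: "continuous_on UNIV ?g"
    by (intro continuous_intros) auto
  then have "bounded (range ?g)"
    using comp by (intro compact_imp_bounded compact_continuous_image)
  with cont have "?g \<in> bcontfun"
    by (auto simp: bcontfun_def)
  then have z: "apply_bcontfun (Bcontfun ?g) = ?g"
    by (rule Bcontfun_inverse)
  show ?case
  proof (rule exI[of _ "Bcontfun ?g"], rule allI, rule conjI)
    fix \<omega>
    show "\<forall>k\<le>Suc n. apply_bcontfun (Bcontfun ?g) \<omega> \<le> apply_bcontfun (f k) \<omega>"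
      unfolding z using y(1) by (auto simp: le_Suc_eq min_le_iff_disj)
    show "\<exists>k\<le>Suc n. apply_bcontfun (Bcontfun ?g) \<omega> = apply_bcontfun (f k) \<omega>"
      unfolding z using y(2)[of \<omega>] by (metis le_Suc_eq min_def)
  qed
qed

lemma rho_bar_plus_le:
  fixes T :: "('a::topological_space \<Rightarrow>\<^sub>C real) \<Rightarrow> ('a \<Rightarrow>\<^sub>C real)"
  assumes "compact (UNIV :: 'a set)" "order_preserving T" "commutes_with_constants T"
    and sub: "\<And>\<omega>. apply_bcontfun (T y) \<omega> \<le> apply_bcontfun y \<omega> + s"
  shows "rho_bar_plus T \<le> s"
proof -
  have "rho_bar_plus T \<le> (SUP \<omega>. apply_bcontfun (T y) \<omega> - apply_bcontfun y \<omega>)"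
    unfolding rho_bar_plus_def
    by (rule cINF_lower[OF bdd_below_SUP_displacement[OF assms(1-3)] UNIV_I])
  also have "\<dots> \<le> s"
    using sub by (intro cSUP_least) (auto simp: algebra_simps)
  finally show ?thesis .
qed

text \<open>
  The subsolution is the lower envelope of the drift-corrected iterates of index at most \<open>n\<close>.
  At a point where it is attained by an index \<open>j > 0\<close>, compare with the image of the iterate of
  index \<open>j - 1\<close>; where it is attained by \<open>x\<close> itself, use an index at which the orbit lags.
\<close>
lemma lagging_orbit_gives_subsolution:
  fixes T :: "('a::topological_space \<Rightarrow>\<^sub>C real) \<Rightarrow> ('a \<Rightarrow>\<^sub>C real)"
  assumes comp: "compact (UNIV :: 'a set)"
    and mono: "order_preserving T" and const: "commutes_with_constants T"
    and lag: "\<And>\<omega>. \<exists>k\<le>n. apply_bcontfun ((T ^^ Suc k) x) \<omega> \<le> apply_bcontfun x \<omega> + real (Suc k) * s"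
  shows "\<exists>y. \<forall>\<omega>. apply_bcontfun (T y) \<omega> \<le> apply_bcontfun y \<omega> + s"
proof -
  define f where "f k = const_bcontfun (- real k * s) + (T ^^ k) x" for k
  have f: "apply_bcontfun (f k) \<omega> = apply_bcontfun ((T ^^ k) x) \<omega> - real k * s" for k \<omega>
    by (simp add: f_def const_bcontfun.rep_eq)
  obtain y where below: "\<And>\<omega> k. k \<le> n \<Longrightarrow> apply_bcontfun y \<omega> \<le> apply_bcontfun (f k) \<omega>"
    and attained: "\<And>\<omega>. \<exists>k\<le>n. apply_bcontfun y \<omega> = apply_bcontfun (f k) \<omega>"
    using finite_lower_envelope[OF comp, of n f] by blast
  have step: "apply_bcontfun (T y) \<omega> \<le> apply_bcontfun (f (Suc k)) \<omega> + s" if "k \<le> n" for k \<omega>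
  proof -
    have "apply_bcontfun (T y) \<omega> \<le> apply_bcontfun (T (f k)) \<omega>"
      using mono below[OF that] by (rule order_preservingD)
    also have "T (f k) = const_bcontfun (- real k * s) + (T ^^ Suc k) x"
      using const by (simp add: f_def commutes_with_constants_def)
    also have "apply_bcontfun \<dots> \<omega> = apply_bcontfun (f (Suc k)) \<omega> + s"
      unfolding f by (simp add: const_bcontfun.rep_eq algebra_simps)
    finally show ?thesis .
  qed
  have "apply_bcontfun (T y) \<omega> \<le> apply_bcontfun y \<omega> + s" for \<omega>
  proof -
    obtain j where j: "j \<le> n" "apply_bcontfun y \<omega> = apply_bcontfun (f j) \<omega>"
      using attained by blast
    show ?thesis
    proof (cases j)
      case 0
      obtain k where k: "k \<le> n" "apply_bcontfun (f (Suc k)) \<omega> \<le> apply_bcontfun (f 0) \<omega>"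
        using lag[of \<omega>] unfolding f by (auto simp: algebra_simps)
      show ?thesis
        using step[OF k(1), of \<omega>] k(2) j(2) 0 by simp
    next
      case (Suc i)
      then show ?thesis
        using step[of i \<omega>] j by simp
    qed
  qed
  then show ?thesis by blast
qed

lemma keeps_up_for_finite_time:
  fixes T :: "('a::topological_space \<Rightarrow>\<^sub>C real) \<Rightarrow> ('a \<Rightarrow>\<^sub>C real)"
  assumes "compact (UNIV :: 'a set)" "order_preserving T" "commutes_with_constants T"
    and s: "s < rho_bar_plus T"
  shows "\<exists>\<omega>. \<forall>k\<le>n. apply_bcontfun x \<omega> + real k * s \<le> apply_bcontfun ((T ^^ k) x) \<omega>"
proof (rule ccontr)
  assume "\<not> ?thesis"
  then have late: "\<exists>k\<le>n. apply_bcontfun ((T ^^ k) x) \<omega> < apply_bcontfun x \<omega> + real k * s" for \<omega>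
    by (meson not_le)
  have "\<exists>k\<le>n. apply_bcontfun ((T ^^ Suc k) x) \<omega> \<le> apply_bcontfun x \<omega> + real (Suc k) * s" for \<omega>
  proof -
    obtain k where k: "k \<le> n" "apply_bcontfun ((T ^^ k) x) \<omega> < apply_bcontfun x \<omega> + real k * s"
      using late by blast
    then obtain i where "k = Suc i"
      by (cases k) auto
    with k show ?thesis
      by (intro exI[of _ i]) simp
  qed
  from lagging_orbit_gives_subsolution[OF assms(1-3) this]
  obtain y where "\<And>\<omega>. apply_bcontfun (T y) \<omega> \<le> apply_bcontfun y \<omega> + s"
    by blast
  from rho_bar_plus_le[OF assms(1-3) this] s show False
    by simp
qed

theorem corollary23:
  fixes T :: "('a::topological_space \<Rightarrow>\<^sub>C real) \<Rightarrow> ('a \<Rightarrow>\<^sub>C real)"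
  assumes "compact (UNIV :: 'a set)"
    and "order_preserving T"
    and "commutes_with_constants T"
  shows "\<forall>x. \<exists>\<omega>. \<forall>k::nat.
           apply_bcontfun ((T ^^ k) x) \<omega> \<ge> apply_bcontfun x \<omega> + real k * rho_bar_plus T"
proof
  fix x
  let ?r = "rho_bar_plus T"
  let ?I = "(UNIV :: nat set) \<times> {..<?r}"
  define K where "K = (\<lambda>(k, s). {\<omega>.
      apply_bcontfun x \<omega> + real k * s \<le> apply_bcontfun ((T ^^ k) x) \<omega>})"
  have "UNIV \<inter> (\<Inter>p\<in>?I. K p) \<noteq> {}"
  proof (rule compact_imp_fip_image[OF assms(1)])
    fix p :: "nat \<times> real"
    assume "p \<in> ?I"
    show "closed (K p)"
      unfolding K_def case_prod_beta
      by (intro closed_Collect_le continuous_intros) auto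
  next
    fix J
    assume J: "finite J" "J \<subseteq> ?I"
    obtain n where n: "\<And>p. p \<in> J \<Longrightarrow> fst p \<le> n"
      using J(1) finite_nat_set_iff_bounded_le[of "fst ` J"] by auto
    \<comment> \<open>Inserting a speed below \<open>\<rho>\<close> makes the maximum meaningful for empty \<open>J\<close> as well.\<close>
    define s where "s = Max (insert (?r - 1) (snd ` J))"
    have s: "snd p \<le> s" if "p \<in> J" for p
      unfolding s_def using J(1) that by (intro Max_ge) auto
    have "s < ?r"
      unfolding s_def using J by (subst Max_less_iff) auto
    then obtain \<omega>
      where \<omega>: "\<And>k. k \<le> n \<Longrightarrow> apply_bcontfun x \<omega> + real k * s \<le> apply_bcontfun ((T ^^ k) x) \<omega>"
      using keeps_up_for_finite_time[OF assms] by blast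
    have "\<omega> \<in> K p" if "p \<in> J" for p
    proof -
      have "real (fst p) * snd p \<le> real (fst p) * s"
        using s[OF that] by (rule mult_left_mono) simp
      then show ?thesis
        using \<omega>[OF n[OF that]] J(2) that by (auto simp: K_def case_prod_beta)
    qed
    then show "UNIV \<inter> (\<Inter>p\<in>J. K p) \<noteq> {}"
      by blast
  qed
  then obtain \<omega> where "\<And>p. p \<in> ?I \<Longrightarrow> \<omega> \<in> K p"
    by blast
  then have \<omega>: "apply_bcontfun x \<omega> + real k * s \<le> apply_bcontfun ((T ^^ k) x) \<omega>" if "s < ?r" for k s
    using that by (force simp: K_def)
  have "apply_bcontfun x \<omega> + real k * ?r \<le> apply_bcontfun ((T ^^ k) x) \<omega>" for k
  proof (cases "k = 0")
    case False
    have "?r \<le> (apply_bcontfun ((T ^^ k) x) \<omega> - apply_bcontfun x \<omega>) / real k"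
    proof (rule dense_le)
      fix s
      assume "s < ?r"
      from \<omega>[OF this, of k] have "s * real k \<le> apply_bcontfun ((T ^^ k) x) \<omega> - apply_bcontfun x \<omega>"
        by (simp only: mult.commute[of s] le_diff_eq add.commute)
      then show "s \<le> (apply_bcontfun ((T ^^ k) x) \<omega> - apply_bcontfun x \<omega>) / real k"
        using False by (simp add: pos_le_divide_eq)
    qed
    then have "?r * real k \<le> apply_bcontfun ((T ^^ k) x) \<omega> - apply_bcontfun x \<omega>"
      using False by (simp add: pos_le_divide_eq)
    then show ?thesis
      by (simp only: mult.commute[of ?r] le_diff_eq add.commute)
  qed simp
  then show "\<exists>\<omega>. \<forall>k::nat.
      apply_bcontfun ((T ^^ k) x) \<omega> \<ge> apply_bcontfun x \<omega> + real k * ?r"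
    by blast
qed

end
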